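(* Let $V$ be a real vector space endowed with a partial order $\preceq$ making it an ordered vector space, let $X\subseteq V$ be a convex cone, let $\mathbf{C}\subseteq X\times X$ be a convex-conic symmetric preorder on $X$, and let $(\mathbb{V},\leq)$ be a Dedekind-complete Riesz space. Suppose that $P:X\to \mathbb{V}\cup\{-\infty\}$ is $\mathbf{C}$-superlinear and $H:X\to \mathbb{V}\cup\{-\infty\}$ is $\mathbf{C}$-sublinear and monotone. If $P(x)\leq H(x)$ for all $x\in X$, then there exists a $\mathbf{C}$-linear map $Q:X\to \mathbb{V}\cup\{-\infty\}$ such that $P(x)\leq Q(x)\leq H(x)$ for all $x\in X$.
   Context: All vector spaces are real. A subset $X$ of a vector space $V$ is a convex cone if $\lambda X\subseteq X$ for all $\lambda>0$ and $X+X\subseteq X$ (so $0$ need not belong to $X$). A binary relation $\mathbf{C}\subseteq X\times X$ on a convex cone $X$ (write $x\mathbf{C}y$ for $(x,y)\in\mathbf{C}$) is a convex-conic symmetric preorder if it is reflexive, transitive, symmetric, and satisfies: (i) $(\lambda x)\mathbf{C}x$ for all $x\in X$ and $\lambda>0$; (ii) for all $x,y,z\in X$, if $x\mathbf{C}y$ and $y\mathbf{C}z$, then $(x+y)\mathbf{C}z$. An ordered vector space is a vector space with a partial order compatible with addition and with multiplication by nonnegative scalars. A Riesz space is an ordered vector space that is a lattice; it is Dedekind-complete if each (nonempty) subset that is bounded from above has a supremum. The element $-\infty$ is adjoined to $\mathbb{V}$ with $-\infty\leq v$ for all $v\in\mathbb{V}$, with the usual arithmetic $v+(-\infty)=(-\infty)+v=-\infty$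 for all $v\in\mathbb{V}\cup\{-\infty\}$, $\lambda\cdot(-\infty)=-\infty$ for $\lambda>0$, and the convention $0\cdot(-\infty)=0_{\mathbb{V}}$. A map $F:X\to\mathbb{V}\cup\{-\infty\}$ is positively homogeneous if $F(\lambda x)=\lambda F(x)$ for all $\lambda>0$ and $x\in X$. It is $\mathbf{C}$-sublinear (respectively $\mathbf{C}$-superlinear, $\mathbf{C}$-linear) if it is positively homogeneous and $F(x+y)\leq F(x)+F(y)$ (respectively $\geq$, $=$) for all $x,y\in X$ with $x\mathbf{C}y$. It is monotone if $x\preceq y$ implies $F(x)\leq F(y)$ for all $x,y\in X$. *)

theory Defs
  imports Complex_Main "HOL-Library.Lattice_Constructions"
begin

text \<open>
  The element \<open>-\<infinity>\<close> is adjoined to an ordered vector space with the type constructor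
  \<open>bot\<close>: its elements are \<open>Value v\<close> and \<open>Bot\<close>, and \<open>Bot\<close> lies below every element.
  The constructors are written qualified because the library reuses their names for
  \<open>flat_complete_lattice\<close>.
\<close>

instantiation bot :: (plus) plus
begin

fun plus_bot :: "'a bot \<Rightarrow> 'a bot \<Rightarrow> 'a bot" where
  "bot.Value a + bot.Value b = bot.Value (a + b)"
| "bot.Bot + y = bot.Bot"
| "x + bot.Bot = bot.Bot"

instance ..

end

text \<open>
  For \<open>r < 0\<close> the value of \<open>r *\<^sub>R Bot\<close> is a dummy; only \<open>r \<ge> 0\<close> is meaningful.
\<close>

instantiation bot :: ("{scaleR, zero}") scaleR
begin

fun scaleR_bot :: "real \<Rightarrow> 'a bot \<Rightarrow> 'a bot" where
  "r *\<^sub>R bot.Value a = bot.Value (r *\<^sub>R a)"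
| "r *\<^sub>R bot.Bot = (if r = 0 then bot.Value 0 else bot.Bot)"

instance ..

end

text \<open>
  Unlike the library's \<open>cone\<close> and \<open>convex_cone\<close>, a cone here need not contain \<open>0\<close>.
\<close>

definition is_convex_cone :: "'v::real_vector set \<Rightarrow> bool" where
  "is_convex_cone X \<longleftrightarrow>
     (\<forall>r>0. \<forall>x\<in>X. r *\<^sub>R x \<in> X) \<and> (\<forall>x\<in>X. \<forall>y\<in>X. x + y \<in> X)"

definition convex_conic_sym_preorder :: "'v::real_vector set \<Rightarrow> ('v \<times> 'v) set \<Rightarrow> bool" where
  "convex_conic_sym_preorder X C \<longleftrightarrow>
     C \<subseteq> X \<times> X \<and> refl_on X C \<and> trans C \<and> sym C \<and>
     (\<forall>x\<in>X. \<forall>r>0. (r *\<^sub>R x, x) \<in> C) \<and>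
     (\<forall>x\<in>X. \<forall>y\<in>X. \<forall>z\<in>X. (x, y) \<in> C \<longrightarrow> (y, z) \<in> C \<longrightarrow> (x + y, z) \<in> C)"

definition pos_homogeneous_on ::
    "'v::real_vector set \<Rightarrow> ('v \<Rightarrow> 'w::real_vector bot) \<Rightarrow> bool" where
  "pos_homogeneous_on X F \<longleftrightarrow> (\<forall>r>0. \<forall>x\<in>X. F (r *\<^sub>R x) = r *\<^sub>R F x)"

definition C_sublinear_on ::
    "'v::real_vector set \<Rightarrow> ('v \<times> 'v) set \<Rightarrow> ('v \<Rightarrow> 'w::ordered_real_vector bot) \<Rightarrow> bool" where
  "C_sublinear_on X C F \<longleftrightarrow> pos_homogeneous_on X F \<and>
     (\<forall>x\<in>X. \<forall>y\<in>X. (x, y) \<in> C \<longrightarrow> F (x + y) \<le> F x + F y)"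

definition C_superlinear_on ::
    "'v::real_vector set \<Rightarrow> ('v \<times> 'v) set \<Rightarrow> ('v \<Rightarrow> 'w::ordered_real_vector bot) \<Rightarrow> bool" where
  "C_superlinear_on X C F \<longleftrightarrow> pos_homogeneous_on X F \<and>
     (\<forall>x\<in>X. \<forall>y\<in>X. (x, y) \<in> C \<longrightarrow> F (x + y) \<ge> F x + F y)"

definition C_linear_on ::
    "'v::real_vector set \<Rightarrow> ('v \<times> 'v) set \<Rightarrow> ('v \<Rightarrow> 'w::real_vector bot) \<Rightarrow> bool" where
  "C_linear_on X C F \<longleftrightarrow> pos_homogeneous_on X F \<and>
     (\<forall>x\<in>X. \<forall>y\<in>X. (x, y) \<in> C \<longrightarrow> F (x + y) = F x + F y)"

end

theory Submission
  imports Defs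
begin

text \<open>
  The classes of \<open>C\<close> are convex cones, so it suffices to find an additive map on each class \<open>K\<close>.
  There \<open>Q\<close> is finite exactly on the face \<open>F\<close> of \<open>K\<close> generated by the points where \<open>P\<close> is
  finite; \<open>H\<close> is finite on \<open>F\<close>, but \<open>P\<close> need not be. On \<open>F\<close> one looks for a minimal sublinear
  \<open>q \<le> H\<close> subject to the inequality \<open>q x + P y \<le> q (x + y)\<close>, which implies \<open>P \<le> q\<close> and, unlike
  \<open>P \<le> q\<close> itself, survives passing from \<open>q\<close> to \<open>x \<mapsto> inf\<^sub>t\<^sub>>\<^sub>0 (q (x + t a) - t q a)\<close>. So a
  minimal \<open>q\<close> satisfies \<open>q x \<le> q (x + a) - q a\<close>, i.e. it is additive.
\<close>

section \<open>The finite-valued sandwich problem on a cone\<close>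

text \<open>
  \<open>D\<close> plays the role of the domain of finiteness of \<open>P\<close>, with \<open>0\<close> adjoined.
\<close>

locale cone_sandwich =
  fixes F D :: "'v::real_vector set"
    and p h :: "'v \<Rightarrow> 'w::{ordered_real_vector, conditionally_complete_lattice}"
  assumes F_scale: "\<And>r x. r > 0 \<Longrightarrow> x \<in> F \<Longrightarrow> r *\<^sub>R x \<in> F"
    and F_add: "\<And>x y. x \<in> F \<Longrightarrow> y \<in> F \<Longrightarrow> x + y \<in> F"
    and D_sub: "D \<subseteq> insert 0 F"
    and D_zero: "0 \<in> D"
    and D_scale: "\<And>r x. r > 0 \<Longrightarrow> x \<in> D \<Longrightarrow> r *\<^sub>R x \<in> D"
    and D_add: "\<And>x y. x \<in> D \<Longrightarrow> y \<in> D \<Longrightarrow> x + y \<in> D"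
    and p_zero: "p 0 = 0"
    and p_scale: "\<And>r x. r > 0 \<Longrightarrow> x \<in> D \<Longrightarrow> p (r *\<^sub>R x) = r *\<^sub>R p x"
    and p_add: "\<And>x y. x \<in> D \<Longrightarrow> y \<in> D \<Longrightarrow> p x + p y \<le> p (x + y)"
    and h_scale: "\<And>r x. r > 0 \<Longrightarrow> x \<in> F \<Longrightarrow> h (r *\<^sub>R x) = r *\<^sub>R h x"
    and h_add: "\<And>x y. x \<in> F \<Longrightarrow> y \<in> F \<Longrightarrow> h (x + y) \<le> h x + h y"
    and p_le_h: "\<And>x. x \<in> D \<Longrightarrow> x \<in> F \<Longrightarrow> p x \<le> h x"
    and face: "\<And>x. x \<in> F \<Longrightarrow> \<exists>z\<in>F. x + z \<in> D"
begin

lemma F_add_D: "x \<in> F \<Longrightarrow> y \<in> D \<Longrightarrow> x + y \<in> F"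
  using D_sub F_add by auto

text \<open>
  Fixing the value \<open>0\<close> outside \<open>F\<close> makes the pointwise order on these maps antisymmetric.
\<close>

definition admissible :: "('v \<Rightarrow> 'w) \<Rightarrow> bool" where
  "admissible q \<longleftrightarrow>
     (\<forall>x. x \<notin> F \<longrightarrow> q x = 0) \<and>
     (\<forall>r>0. \<forall>x\<in>F. q (r *\<^sub>R x) = r *\<^sub>R q x) \<and>
     (\<forall>x\<in>F. \<forall>y\<in>F. q (x + y) \<le> q x + q y) \<and>
     (\<forall>x\<in>F. q x \<le> h x) \<and>
     (\<forall>x\<in>F. \<forall>y\<in>D. q x + p y \<le> q (x + y))"

section \<open>Bounds and infima of admissible maps\<close>

lemma admissibleD:
  assumes "admissible q"
  shows "x \<notin> F \<Longrightarrow> q x = 0"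
    and "r > 0 \<Longrightarrow> x \<in> F \<Longrightarrow> q (r *\<^sub>R x) = r *\<^sub>R q x"
    and "x \<in> F \<Longrightarrow> y \<in> F \<Longrightarrow> q (x + y) \<le> q x + q y"
    and "x \<in> F \<Longrightarrow> q x \<le> h x"
    and "x \<in> F \<Longrightarrow> y \<in> D \<Longrightarrow> q x + p y \<le> q (x + y)"
  using assms by (auto simp: admissible_def)

text \<open>Doubling replaces an evaluation at \<open>0\<close>, which need not belong to
  \<open>F\<close>: the lower inequality and subadditivity bound \<open>q (x + x)\<close> from both
  sides, and one \<open>q x\<close> cancels.\<close>

lemma admissible_ge:
  assumes q: "admissible q" and x: "x \<in> D" "x \<in> F"
  shows "p x \<le> q x"
proof -
  have "q x + p x \<le> q (x + x)"
    using admissibleD(5)[OF q] x by blast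
  also have "\<dots> \<le> q x + q x"
    using admissibleD(3)[OF q] x by blast
  finally show ?thesis by simp
qed

text \<open>The bound does not mention \<open>q\<close>, so it serves all admissible maps at once
  and makes pointwise infima of chains exist.\<close>

lemma admissible_lower_bound:
  assumes q: "admissible q" and "x \<in> F" "z \<in> F" "x + z \<in> D"
  shows "p (x + z) - h z \<le> q x"
proof -
  have "p (x + z) \<le> q (x + z)"
    using admissible_ge[OF q] assms F_add by blast
  also have "\<dots> \<le> q x + q z"
    using admissibleD(3)[OF q] assms by blast
  also have "\<dots> \<le> q x + h z"
    using admissibleD(4)[OF q] assms by simp
  finally show ?thesis by (simp add: diff_le_eq)
qed

text \<open>Used for three infima: the initial map, the lower bound of a chain, and the perturbation
  of a minimal map. Most conditions may pass from the index \<open>i\<close> to some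
  \<open>k\<close>, because a single \<open>G i\<close> need not be admissible.\<close>

lemma admissible_INF:
  fixes G :: "'i \<Rightarrow> 'v \<Rightarrow> 'w" and I :: "'i set"
  defines "q \<equiv> (\<lambda>x. if x \<in> F then INF i\<in>I. G i x else 0)"
  assumes ne: "I \<noteq> {}"
    and bdd: "\<And>x. x \<in> F \<Longrightarrow> bdd_below ((\<lambda>i. G i x) ` I)"
    and scale: "\<And>i r x. i \<in> I \<Longrightarrow> r > 0 \<Longrightarrow> x \<in> F \<Longrightarrow> \<exists>k\<in>I. G k (r *\<^sub>R x) \<le> r *\<^sub>R G i x"
    and add: "\<And>i j x y. i \<in> I \<Longrightarrow> j \<in> I \<Longrightarrow> x \<in> F \<Longrightarrow> y \<in> F \<Longrightarrow>
      \<exists>k\<in>I. G k (x + y) \<le> G i x + G j y"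
    and le: "\<And>x. x \<in> F \<Longrightarrow> \<exists>i\<in>I. G i x \<le> h x"
    and ge: "\<And>i x y. i \<in> I \<Longrightarrow> x \<in> F \<Longrightarrow> y \<in> D \<Longrightarrow> \<exists>k\<in>I. G k x + p y \<le> G i (x + y)"
  shows "admissible q"
proof -
  have q_le: "q x \<le> c" if "x \<in> F" "i \<in> I" "G i x \<le> c" for x i c
  proof -
    have "q x \<le> G i x"
      using that cINF_lower[OF bdd] by (simp add: q_def)
    with that show ?thesis by simp
  qed
  have q_ge: "c \<le> q x" if "x \<in> F" "\<And>i. i \<in> I \<Longrightarrow> c \<le> G i x" for x c
    using that cINF_greatest[OF ne, of c "\<lambda>i. G i x"] by (simp add: q_def)
  have sc_le: "q (r *\<^sub>R x) \<le> r *\<^sub>R q x" if "r > 0" "x \<in> F" for r x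
  proof -
    \<comment> \<open>The factor is moved to the left so that the right side is a bare
      infimum.\<close>
    have "inverse r *\<^sub>R q (r *\<^sub>R x) \<le> q x"
    proof (rule q_ge[OF that(2)])
      fix i assume "i \<in> I"
      then obtain k where "k \<in> I" "G k (r *\<^sub>R x) \<le> r *\<^sub>R G i x"
        using scale \<open>r > 0\<close> \<open>x \<in> F\<close> by blast
      then have "q (r *\<^sub>R x) \<le> r *\<^sub>R G i x"
        using q_le F_scale that by blast
      then have "inverse r *\<^sub>R q (r *\<^sub>R x) \<le> inverse r *\<^sub>R (r *\<^sub>R G i x)"
        using \<open>r > 0\<close> by (intro scaleR_left_mono) auto
      then show "inverse r *\<^sub>R q (r *\<^sub>R x) \<le> G i x"
        using \<open>r > 0\<close> by simp
    qed
    then have "r *\<^sub>R (inverse r *\<^sub>R q (r *\<^sub>R x)) \<le> r *\<^sub>R q x"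
      using \<open>r > 0\<close> by (intro scaleR_left_mono) auto
    then show ?thesis
      using \<open>r > 0\<close> by simp
  qed
  have sc: "q (r *\<^sub>R x) = r *\<^sub>R q x" if "r > 0" "x \<in> F" for r x
  proof (rule antisym[OF sc_le[OF that]])
    \<comment> \<open>The converse is the same inequality for \<open>inverse r\<close> at the point
      \<open>r *\<^sub>R x\<close>.\<close>
    have "q (inverse r *\<^sub>R (r *\<^sub>R x)) \<le> inverse r *\<^sub>R q (r *\<^sub>R x)"
      using that by (intro sc_le F_scale) auto
    then have "r *\<^sub>R q x \<le> r *\<^sub>R (inverse r *\<^sub>R q (r *\<^sub>R x))"
      using that by (intro scaleR_left_mono) auto
    then show "r *\<^sub>R q x \<le> q (r *\<^sub>R x)"
      using that by simp
  qed
  have ad: "q (x + y) \<le> q x + q y" if xy: "x \<in> F" "y \<in> F" for x y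
  proof -
    have "q (x + y) - q y \<le> q x"
    proof (rule q_ge[OF xy(1)])
      fix i assume i: "i \<in> I"
      have "q (x + y) - G i x \<le> q y"
      proof (rule q_ge[OF xy(2)])
        fix j assume j: "j \<in> I"
        obtain k where "k \<in> I" "G k (x + y) \<le> G i x + G j y"
          using add[OF i j xy] by blast
        then have "q (x + y) \<le> G i x + G j y"
          using q_le F_add xy by blast
        then show "q (x + y) - G i x \<le> G j y"
          by (simp add: diff_le_eq add.commute)
      qed
      then show "q (x + y) - q y \<le> G i x"
        by (simp add: diff_le_eq add.commute)
    qed
    then show ?thesis by (simp add: diff_le_eq)
  qed
  have lower: "q x + p y \<le> q (x + y)" if xy: "x \<in> F" "y \<in> D" for x y
  proof (rule q_ge[OF F_add_D[OF xy]])
    fix i assume "i \<in> I"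
    then obtain k where k: "k \<in> I" "G k x + p y \<le> G i (x + y)"
      using ge xy by blast
    have "q x + p y \<le> G k x + p y"
      using q_le[OF xy(1) k(1)] by simp
    also note k(2)
    finally show "q x + p y \<le> G i (x + y)" .
  qed
  have "q x \<le> h x" if "x \<in> F" for x
    using le[OF that] q_le[OF that] by blast
  then show ?thesis
    using sc ad lower by (simp add: admissible_def) (simp add: q_def)
qed

section \<open>Existence of a minimal admissible map\<close>

text \<open>The chosen infimum is the largest candidate:
  \<open>q x + p y \<le> q (x + y) \<le> h (x + y)\<close> forces every admissible \<open>q\<close>
  below it.\<close>

lemma ex_admissible: "\<exists>q. admissible q"
proof
  show "admissible (\<lambda>x. if x \<in> F then INF y\<in>D. h (x + y) - p y else 0)"
  proof (rule admissible_INF)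
    show "D \<noteq> {}" using D_zero by blast
  next
    fix x assume x: "x \<in> F"
    then obtain z where z: "z \<in> F" "x + z \<in> D"
      using face by blast
    \<comment> \<open>A completing \<open>z\<close> gives a bound independent of \<open>y\<close>:
      \<open>p\<close> is compared with \<open>h\<close> at \<open>x + z + y\<close>, and then
      \<open>h z\<close> is split off.\<close>
    have "p (x + z) - h z \<le> h (x + y) - p y" if y: "y \<in> D" for y
    proof -
      have "p (x + z) + p y \<le> p (x + z + y)"
        using p_add z y by blast
      also have "\<dots> \<le> h (x + z + y)"
        using p_le_h D_add F_add F_add_D x y z by blast
      also have "\<dots> = h ((x + y) + z)"
        by (simp add: algebra_simps)
      also have "\<dots> \<le> h (x + y) + h z"
        using h_add F_add_D x y z by blast
      finally show ?thesis by (simp add: algebra_simps)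
    qed
    then show "bdd_below ((\<lambda>y. h (x + y) - p y) ` D)"
      by (rule bdd_belowI2)
  next
    fix y x and r :: real
    assume "y \<in> D" "r > 0" "x \<in> F"
    then have "h (r *\<^sub>R x + r *\<^sub>R y) - p (r *\<^sub>R y) = r *\<^sub>R (h (x + y) - p y)"
      using h_scale[of r "x + y"] F_add_D p_scale by (simp add: algebra_simps)
    then show "\<exists>k\<in>D. h (r *\<^sub>R x + k) - p k \<le> r *\<^sub>R (h (x + y) - p y)"
      using D_scale \<open>r > 0\<close> \<open>y \<in> D\<close> by (metis order_refl)
  next
    fix i j x y
    assume ij: "i \<in> D" "j \<in> D" and xy: "x \<in> F" "y \<in> F"
    have "h (x + y + (i + j)) = h ((x + i) + (y + j))"
      by (simp add: algebra_simps)
    also have "\<dots> \<le> h (x + i) + h (y + j)"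
      using h_add F_add_D ij xy by blast
    finally have "h (x + y + (i + j)) - p (i + j) \<le> (h (x + i) + h (y + j)) - (p i + p j)"
      using p_add[OF ij] by (rule diff_mono)
    then have "h (x + y + (i + j)) - p (i + j) \<le> (h (x + i) - p i) + (h (y + j) - p j)"
      by (simp add: algebra_simps)
    then show "\<exists>k\<in>D. h (x + y + k) - p k \<le> (h (x + i) - p i) + (h (y + j) - p j)"
      using D_add[OF ij] by blast
  next
    fix x
    show "\<exists>y\<in>D. h (x + y) - p y \<le> h x"
      using D_zero p_zero by (intro bexI[of _ 0]) auto
  next
    fix i x y
    assume i: "i \<in> D" and "x \<in> F" and y: "y \<in> D"
    \<comment> \<open>Replacing the index \<open>i\<close> by \<open>y + i\<close> absorbs the shift
      of \<open>x\<close>; superadditivity of \<open>p\<close> pays for the term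
      \<open>p y\<close>.\<close>
    have "h (x + (y + i)) - p (y + i) + p y \<le> h (x + (y + i)) - (p y + p i) + p y"
      using p_add[OF y i] by (intro add_right_mono diff_left_mono)
    then have "h (x + (y + i)) - p (y + i) + p y \<le> h (x + y + i) - p i"
      by (simp add: algebra_simps)
    then show "\<exists>k\<in>D. h (x + k) - p k + p y \<le> h (x + y + i) - p i"
      using D_add[OF y i] by blast
  qed
qed

text \<open>Zorn's lemma downwards: the pointwise infimum of a nonempty chain exists by the uniform
  lower bound and is again admissible.\<close>

lemma minimal_admissible:
  "\<exists>m. admissible m \<and> (\<forall>q. admissible q \<longrightarrow> q \<le> m \<longrightarrow> q = m)"
proof -
  \<comment> \<open>The order is reversed, so that a maximal element for \<open>?R\<close> is a
    minimal map.\<close>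
  let ?R = "relation_of (\<lambda>q q'. q' \<le> q) (Collect admissible)"
  have "\<exists>m\<in>Collect admissible. \<forall>q\<in>Collect admissible. q \<le> m \<longrightarrow> q = m"
  proof (rule predicate_Zorn)
    show "partial_order_on (Collect admissible) ?R"
      by (rule partial_order_on_relation_ofI) auto
  next
    fix I assume I: "I \<in> Chains ?R"
    show "\<exists>u\<in>Collect admissible. \<forall>q\<in>I. u \<le> q"
    proof (cases "I = {}")
      case True
      then show ?thesis using ex_admissible by auto
    next
      case False
      have adm: "admissible q" if "q \<in> I" for q
        using I that by (auto simp: Chains_def relation_of_def)
      have comparable: "q \<le> q' \<or> q' \<le> q" if "q \<in> I" "q' \<in> I" for q q'
        using I that by (auto simp: Chains_def relation_of_def)
      have bdd: "bdd_below ((\<lambda>q. q x) ` I)" if x: "x \<in> F" for x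
      proof -
        obtain z where "z \<in> F" "x + z \<in> D"
          using face x by blast
        then show ?thesis
          using admissible_lower_bound[OF adm x] by (intro bdd_belowI2[of I]) blast
      qed
      let ?u = "\<lambda>x. if x \<in> F then INF q\<in>I. q x else 0"
      have "admissible ?u"
      proof (rule admissible_INF[OF False bdd])
        fix q q' x y
        assume q: "q \<in> I" "q' \<in> I" and xy: "x \<in> F" "y \<in> F"
        \<comment> \<open>Comparability in the chain enters here: the smaller of the two maps serves
          as \<open>k\<close>.\<close>
        consider "q \<le> q'" | "q' \<le> q" using comparable q by blast
        then show "\<exists>k\<in>I. k (x + y) \<le> q x + q' y"
        proof cases
          case 1
          have "q (x + y) \<le> q x + q y"
            using admissibleD(3)[OF adm] q xy by blast
          also have "\<dots> \<le> q x + q' y"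
            using 1 by (simp add: le_fun_def)
          finally show ?thesis using q by blast
        next
          case 2
          have "q' (x + y) \<le> q' x + q' y"
            using admissibleD(3)[OF adm] q xy by blast
          also have "\<dots> \<le> q x + q' y"
            using 2 by (simp add: le_fun_def)
          finally show ?thesis using q by blast
        qed
      next
        show "\<exists>q\<in>I. q x \<le> h x" if "x \<in> F" for x
          using False adm admissibleD(4) that by blast
      qed (use adm admissibleD in \<open>metis order_refl\<close>)+
      moreover have "?u \<le> q" if "q \<in> I" for q
        using that cINF_lower[OF bdd that] admissibleD(1)[OF adm[OF that]] by (auto simp: le_fun_def)
      ultimately show ?thesis by blast
    qed
  qed
  then show ?thesis by blast
qed

section \<open>Additivity of minimal maps\<close>

lemma ex_additive_between:
  "\<exists>q. (\<forall>r>0. \<forall>x\<in>F. q (r *\<^sub>R x) = r *\<^sub>R q x) \<and>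
       (\<forall>x\<in>F. \<forall>y\<in>F. q (x + y) = q x + q y) \<and>
       (\<forall>x\<in>F. q x \<le> h x) \<and> (\<forall>x\<in>F \<inter> D. p x \<le> q x)"
proof -
  obtain q where q: "admissible q" and min: "\<And>q'. admissible q' \<Longrightarrow> q' \<le> q \<Longrightarrow> q' = q"
    using minimal_admissible by blast
  note scale = admissibleD(2)[OF q] and add = admissibleD(3)[OF q]
    and le = admissibleD(4)[OF q] and ge = admissibleD(5)[OF q]
  have additive: "q (x + a) = q x + q a" if xa: "x \<in> F" "a \<in> F" for x a
  proof -
    \<comment> \<open>Here \<open>t\<close> runs over all positive reals, so that scaling
      \<open>x\<close> and adding points can be matched by the indices \<open>r * t\<close> and
      \<open>s + t\<close>.\<close>
    let ?G = "\<lambda>t x. q (x + t *\<^sub>R a) - t *\<^sub>R q a"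
    let ?q = "\<lambda>x. if x \<in> F then INF t\<in>{0::real<..}. ?G t x else 0"
    have G_le: "?G t x \<le> q x" if "t > 0" "x \<in> F" for t x
      using add[OF that(2) F_scale[OF that(1) xa(2)]] scale[OF that(1) xa(2)]
      by (simp add: diff_le_eq)
    have bdd: "bdd_below ((\<lambda>t. ?G t x) ` {0<..})" if x: "x \<in> F" for x
    proof -
      obtain z where z: "z \<in> F" "x + z \<in> D"
        using face x by blast
      have "p (x + z) - q z \<le> ?G t x" if t: "t > 0" for t
      proof -
        have ta: "t *\<^sub>R a \<in> F" using F_scale t xa by blast
        \<comment> \<open>The lower inequality is applied at the base point
          \<open>t *\<^sub>R a\<close>, so that \<open>t *\<^sub>R q a\<close> cancels and the bound
          is uniform in \<open>t\<close>.\<close>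
        have "t *\<^sub>R q a + p (x + z) \<le> q (t *\<^sub>R a + (x + z))"
          using ge[OF ta z(2)] scale[OF t xa(2)] by simp
        also have "\<dots> = q ((x + t *\<^sub>R a) + z)"
          by (simp add: algebra_simps)
        also have "\<dots> \<le> q (x + t *\<^sub>R a) + q z"
          using add F_add x ta z by blast
        finally show ?thesis by (simp add: algebra_simps)
      qed
      then show ?thesis by (intro bdd_belowI2) auto
    qed
    have "admissible ?q"
    proof (rule admissible_INF)
      show "{0::real<..} \<noteq> {}" by simp
    next
      fix t r :: real and x
      assume "t \<in> {0<..}" "r > 0" "x \<in> F"
      then have "?G (r * t) (r *\<^sub>R x) = r *\<^sub>R ?G t x"
        using scale[of r "x + t *\<^sub>R a"] F_add F_scale xa by (simp add: algebra_simps)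
      then show "\<exists>k\<in>{0<..}. ?G k (r *\<^sub>R x) \<le> r *\<^sub>R ?G t x"
        using \<open>t \<in> {0<..}\<close> \<open>r > 0\<close> by (intro bexI[of _ "r * t"]) auto
    next
      fix s t :: real and x y
      assume st: "s \<in> {0<..}" "t \<in> {0<..}" and xy: "x \<in> F" "y \<in> F"
      have "q (x + y + (s + t) *\<^sub>R a) = q ((x + s *\<^sub>R a) + (y + t *\<^sub>R a))"
        by (simp add: algebra_simps)
      also have "\<dots> \<le> q (x + s *\<^sub>R a) + q (y + t *\<^sub>R a)"
        using add F_add F_scale st xy xa by simp
      finally have "?G (s + t) (x + y) \<le> ?G s x + ?G t y"
        by (simp add: algebra_simps)
      then show "\<exists>k\<in>{0<..}. ?G k (x + y) \<le> ?G s x + ?G t y"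
        using st by (intro bexI[of _ "s + t"]) auto
    next
      fix x assume "x \<in> F"
      then show "\<exists>t\<in>{0<..}. ?G t x \<le> h x"
        using G_le[of 1 x] le[of x] by (intro bexI[of _ 1]) auto
    next
      fix t :: real and x y
      assume t: "t \<in> {0<..}" and xy: "x \<in> F" "y \<in> D"
      \<comment> \<open>The lower inequality of \<open>q\<close> at the base point
        \<open>x + t *\<^sub>R a\<close> keeps the index \<open>t\<close>.\<close>
      have "q (x + t *\<^sub>R a) + p y \<le> q (x + t *\<^sub>R a + y)"
        using ge F_add F_scale t xy xa by simp
      then have "?G t x + p y \<le> ?G t (x + y)"
        by (simp add: algebra_simps)
      then show "\<exists>k\<in>{0<..}. ?G k x + p y \<le> ?G t (x + y)"
        using t by blast
    qed (rule bdd)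
    moreover have q_le_G: "?q x \<le> ?G t x" if "t > 0" "x \<in> F" for t x
      using that cINF_lower[OF bdd[OF that(2)], of t] by simp
    have "?q \<le> q"
    proof (rule le_funI)
      fix x
      show "?q x \<le> q x"
        using order_trans[OF q_le_G[of 1 x] G_le[of 1 x]] admissibleD(1)[OF q, of x]
        by (cases "x \<in> F") simp_all
    qed
    ultimately have "?q = q" using min by blast
    then have "q x = ?q x"
      by (rule fun_cong[OF sym])
    also have "\<dots> \<le> ?G 1 x"
      using xa by (intro q_le_G) auto
    finally have "q x + q a \<le> q (x + a)"
      by (simp add: le_diff_eq)
    then show ?thesis
      using add[OF xa] by (rule antisym[rotated])
  qed
  show ?thesis
    using scale additive le admissible_ge[OF q] by (intro exI[of _ q]) auto
qed

end

section \<open>Arithmetic with minus infinity\<close>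

lemma bot_add_eq_Bot_iff: "x + y = bot.Bot \<longleftrightarrow> x = bot.Bot \<or> y = bot.Bot"
  by (cases x; cases y) auto

lemma bot_scaleR_eq_Bot_iff: "r > 0 \<Longrightarrow> r *\<^sub>R x = bot.Bot \<longleftrightarrow> x = bot.Bot"
  by (cases x) auto

primrec the_Value :: "'a bot \<Rightarrow> 'a" where
  "the_Value (bot.Value a) = a"

lemma Value_the_Value: "x \<noteq> bot.Bot \<Longrightarrow> bot.Value (the_Value x) = x"
  by (cases x) auto

lemma the_Value_mono: "x \<le> y \<Longrightarrow> x \<noteq> bot.Bot \<Longrightarrow> the_Value x \<le> the_Value y"
  by (cases x; cases y) auto

lemma the_Value_add: "x + y \<noteq> bot.Bot \<Longrightarrow> the_Value (x + y) = the_Value x + the_Value y"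
  by (cases x; cases y) auto

lemma the_Value_scaleR:
  "r > 0 \<Longrightarrow> x \<noteq> bot.Bot \<Longrightarrow> the_Value (r *\<^sub>R x) = r *\<^sub>R the_Value x"
  by (cases x) auto

section \<open>The sandwich theorem on one cone, with minus infinity as a value\<close>

text \<open>Off the face \<open>F\<close> the map \<open>Q\<close> may be set to
  \<open>bot.Bot\<close>, since \<open>P\<close> is \<open>bot.Bot\<close> there and a sum lies in
  \<open>F\<close> exactly when both summands do. On \<open>F\<close> the finite-valued case
  applies.\<close>

lemma cone_sandwich_bot:
  fixes P H :: "'v::real_vector \<Rightarrow> 'w::{ordered_real_vector, conditionally_complete_lattice} bot"
  assumes K_scale: "\<And>r x. r > 0 \<Longrightarrow> x \<in> K \<Longrightarrow> r *\<^sub>R x \<in> K"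
    and K_add: "\<And>x y. x \<in> K \<Longrightarrow> y \<in> K \<Longrightarrow> x + y \<in> K"
    and P_scale: "\<And>r x. r > 0 \<Longrightarrow> x \<in> K \<Longrightarrow> P (r *\<^sub>R x) = r *\<^sub>R P x"
    and P_add: "\<And>x y. x \<in> K \<Longrightarrow> y \<in> K \<Longrightarrow> P x + P y \<le> P (x + y)"
    and H_scale: "\<And>r x. r > 0 \<Longrightarrow> x \<in> K \<Longrightarrow> H (r *\<^sub>R x) = r *\<^sub>R H x"
    and H_add: "\<And>x y. x \<in> K \<Longrightarrow> y \<in> K \<Longrightarrow> H (x + y) \<le> H x + H y"
    and P_le_H: "\<And>x. x \<in> K \<Longrightarrow> P x \<le> H x"
  shows "\<exists>Q. (\<forall>r>0. \<forall>x\<in>K. Q (r *\<^sub>R x) = r *\<^sub>R Q x) \<and>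
    (\<forall>x\<in>K. \<forall>y\<in>K. Q (x + y) = Q x + Q y) \<and> (\<forall>x\<in>K. P x \<le> Q x \<and> Q x \<le> H x)"
proof -
  define DP where "DP = {x \<in> K. P x \<noteq> bot.Bot}"
  define F where "F = {x \<in> K. \<exists>y\<in>K. x + y \<in> DP}"
  \<comment> \<open>The point \<open>0\<close> is adjoined to the domain of \<open>p\<close>, so the
    value there must be \<open>0\<close> even when \<open>0\<close> is not in \<open>K\<close> or
    \<open>P 0\<close> is \<open>bot.Bot\<close>.\<close>
  define p where "p x = (if x = 0 then 0 else the_Value (P x))" for x
  define h where "h x = the_Value (H x)" for x
  have DP_K: "x \<in> K" and DP_P: "P x \<noteq> bot.Bot" if "x \<in> DP" for x
    using that by (auto simp: DP_def)
  have F_K: "x \<in> K" if "x \<in> F" for x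
    using that by (auto simp: F_def)
  have DP_scale: "r *\<^sub>R x \<in> DP" if "r > 0" "x \<in> DP" for r x
    using that by (auto simp: DP_def K_scale P_scale bot_scaleR_eq_Bot_iff)
  have DP_add: "x + y \<in> DP" if "x \<in> DP" "y \<in> DP" for x y
    using that P_add[of x y] bot_add_eq_Bot_iff[of "P x" "P y"]
    by (auto simp: DP_def K_add dest: less_eq_bot_Bot_is_Bot)
  have F_add_iff: "x + y \<in> F \<longleftrightarrow> x \<in> F \<and> y \<in> F" if xy: "x \<in> K" "y \<in> K" for x y
  proof
    assume "x + y \<in> F"
    then obtain z where z: "z \<in> K" "x + y + z \<in> DP"
      by (auto simp: F_def)
    \<comment> \<open>Each summand moves into the witness of the other, which makes \<open>F\<close>
      a face.\<close>
    have "x + (y + z) \<in> DP" "y + (x + z) \<in> DP"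
      using z by (simp_all add: algebra_simps)
    then show "x \<in> F \<and> y \<in> F"
      using xy z K_add by (auto simp: F_def)
  next
    assume "x \<in> F \<and> y \<in> F"
    then obtain u v where u: "u \<in> K" "x + u \<in> DP" and v: "v \<in> K" "y + v \<in> DP"
      by (auto simp: F_def)
    have "(x + u) + (y + v) = (x + y) + (u + v)"
      by (simp add: algebra_simps)
    then have "(x + y) + (u + v) \<in> DP"
      using DP_add[OF u(2) v(2)] by (simp only:)
    then show "x + y \<in> F"
      using u v xy K_add by (auto simp: F_def)
  qed
  have F_scale: "r *\<^sub>R x \<in> F" if r: "r > 0" and x: "x \<in> F" for r x
  proof -
    obtain y where y: "y \<in> K" "x + y \<in> DP"
      using x by (auto simp: F_def)
    have "r *\<^sub>R x + r *\<^sub>R y \<in> DP"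
      using DP_scale[OF r y(2)] by (simp only: scaleR_add_right)
    then show ?thesis
      using K_scale[OF r y(1)] K_scale[OF r F_K[OF x]] by (auto simp: F_def)
  qed
  have F_scale_iff: "r *\<^sub>R x \<in> F \<longleftrightarrow> x \<in> F" if "r > 0" for r x
    using F_scale[of r x] F_scale[of "inverse r" "r *\<^sub>R x"] that by auto
  have DP_F: "x \<in> F" if "x \<in> DP" for x
    using that DP_add[of x x] by (auto simp: F_def DP_def)
  have H_F: "H x \<noteq> bot.Bot" if x: "x \<in> F" for x
  proof
    assume "H x = bot.Bot"
    obtain y where y: "y \<in> K" "x + y \<in> DP"
      using x by (auto simp: F_def)
    \<comment> \<open>With \<open>H x = bot.Bot\<close> the right side would be
      \<open>bot.Bot\<close>, although \<open>P\<close> is finite at \<open>x + y\<close>.\<close>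
    have "P (x + y) \<le> H x + H y"
      using P_le_H[of "x + y"] H_add[of x y] K_add F_K x y(1) by (meson order_trans)
    then show False
      using DP_P[OF y(2)] \<open>H x = bot.Bot\<close> by (simp add: less_eq_bot_Bot_is_Bot)
  qed
  have P_zero: "the_Value (P 0) = 0" if "0 \<in> DP"
  proof -
    \<comment> \<open>Scaling by \<open>2\<close> fixes \<open>0\<close>, so a finite value there
      equals its double.\<close>
    have "2 *\<^sub>R the_Value (P 0) = the_Value (P 0)"
      using P_scale[of 2 0] the_Value_scaleR[of 2 "P 0"] DP_K[OF that] DP_P[OF that] by simp
    then show ?thesis by (simp add: scaleR_2)
  qed
  have p_DP: "p x = the_Value (P x)" if "x \<in> DP" for x
    using that P_zero by (auto simp: p_def)
  interpret cone_sandwich F "insert 0 DP" p h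
  proof
    show "r *\<^sub>R x \<in> F" if "r > 0" "x \<in> F" for r x
      using F_scale that .
    show "x + y \<in> F" if "x \<in> F" "y \<in> F" for x y
      using that F_add_iff F_K by blast
    show "insert 0 DP \<subseteq> insert 0 F"
      using DP_F by blast
    show "r *\<^sub>R x \<in> insert 0 DP" if "r > 0" "x \<in> insert 0 DP" for r x
      using that DP_scale by auto
    show "x + y \<in> insert 0 DP" if "x \<in> insert 0 DP" "y \<in> insert 0 DP" for x y
      using that DP_add by auto
    show "p 0 = 0"
      by (simp add: p_def)
    then show "p (r *\<^sub>R x) = r *\<^sub>R p x" if "r > 0" "x \<in> insert 0 DP" for r x
      using that by (auto simp: p_DP DP_scale P_scale the_Value_scaleR DP_K DP_P)
    show "p x + p y \<le> p (x + y)" if xy: "x \<in> insert 0 DP" "y \<in> insert 0 DP" for x y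
    proof (cases "x \<in> DP \<and> y \<in> DP")
      case True
      then have "P x + P y \<noteq> bot.Bot"
        by (simp add: bot_add_eq_Bot_iff DP_P)
      moreover have "P x + P y \<le> P (x + y)"
        using True P_add DP_K by blast
      ultimately show ?thesis
        using True the_Value_mono by (fastforce simp: p_DP DP_add simp flip: the_Value_add)
    next
      case False
      then show ?thesis
        using xy \<open>p 0 = 0\<close> by auto
    qed
    show "h (r *\<^sub>R x) = r *\<^sub>R h x" if "r > 0" "x \<in> F" for r x
      using that by (simp add: h_def H_scale F_K H_F the_Value_scaleR)
    show "h (x + y) \<le> h x + h y" if xy: "x \<in> F" "y \<in> F" for x y
    proof -
      have "H (x + y) \<noteq> bot.Bot" "H x + H y \<noteq> bot.Bot"
        using xy F_add_iff F_K H_F by (auto simp: bot_add_eq_Bot_iff)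
      then show ?thesis
        using the_Value_mono[OF H_add] xy F_K by (simp add: h_def flip: the_Value_add)
    qed
    show "p x \<le> h x" if "x \<in> insert 0 DP" "x \<in> F" for x
    proof (cases "x \<in> DP")
      case True
      then show ?thesis
        using the_Value_mono[OF P_le_H] by (simp add: p_DP h_def DP_K DP_P)
    next
      case False
      \<comment> \<open>Here \<open>P 0\<close> is \<open>bot.Bot\<close> and \<open>p 0\<close> is
        the adjoined default \<open>0\<close>; homogeneity gives \<open>h 0 = 0\<close> as
        well.\<close>
      then have [simp]: "x = 0" using that by simp
      have "2 *\<^sub>R h 0 = h 0"
        using H_scale[of 2 0] the_Value_scaleR[of 2 "H 0"] F_K[of 0] H_F[of 0] that
        by (simp add: h_def)
      then show ?thesis
        using \<open>p 0 = 0\<close> by (simp add: scaleR_2)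
    qed
    show "\<exists>z\<in>F. x + z \<in> insert 0 DP" if x: "x \<in> F" for x
    proof -
      \<comment> \<open>The witness is only known to lie in \<open>K\<close>; as
        \<open>x + y\<close> is in \<open>DP\<close>, hence in \<open>F\<close>, the face property
        puts \<open>y\<close> in \<open>F\<close>.\<close>
      obtain y where "y \<in> K" "x + y \<in> DP"
        using x by (auto simp: F_def)
      then show ?thesis
        using DP_F F_add_iff F_K x by blast
    qed
  qed simp
  obtain q where q_scale: "\<And>r x. r > 0 \<Longrightarrow> x \<in> F \<Longrightarrow> q (r *\<^sub>R x) = r *\<^sub>R q x"
    and q_add: "\<And>x y. x \<in> F \<Longrightarrow> y \<in> F \<Longrightarrow> q (x + y) = q x + q y"
    and q_h: "\<And>x. x \<in> F \<Longrightarrow> q x \<le> h x"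
    and p_q: "\<And>x. x \<in> F \<Longrightarrow> x \<in> insert 0 DP \<Longrightarrow> p x \<le> q x"
    using ex_additive_between by blast
  define Q where "Q x = (if x \<in> F then bot.Value (q x) else bot.Bot)" for x
  have "Q (r *\<^sub>R x) = r *\<^sub>R Q x" if "r > 0" for r x
    using that by (simp add: Q_def F_scale_iff q_scale)
  moreover have "Q (x + y) = Q x + Q y" if "x \<in> K" "y \<in> K" for x y
    using that by (auto simp: Q_def F_add_iff q_add)
  moreover have "P x \<le> Q x" if "x \<in> K" for x
  proof (cases "x \<in> DP")
    case True
    then have "bot.Value (the_Value (P x)) \<le> Q x"
      using p_q[of x] by (simp add: Q_def DP_F p_DP)
    then show ?thesis
      using True by (simp add: Value_the_Value DP_P)
  next
    case False
    then show ?thesis using that by (simp add: DP_def)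
  qed
  moreover have "Q x \<le> H x" for x
  proof (cases "x \<in> F")
    case True
    then have "Q x \<le> bot.Value (h x)"
      by (simp add: Q_def q_h)
    then show ?thesis
      using True by (simp add: h_def Value_the_Value H_F)
  qed (simp add: Q_def)
  ultimately show ?thesis by blast
qed

section \<open>Gluing over the classes of \<open>C\<close>\<close>

theorem theorem2:
  fixes X :: "'v::ordered_real_vector set"
    and C :: "('v \<times> 'v) set"
    and P H :: "'v \<Rightarrow> 'w::{ordered_real_vector, conditionally_complete_lattice} bot"
  assumes "is_convex_cone X"
    and "convex_conic_sym_preorder X C"
    and "C_superlinear_on X C P"
    and "C_sublinear_on X C H"
    and "mono_on X H"
    and "\<forall>x\<in>X. P x \<le> H x"
  shows "\<exists>Q :: 'v \<Rightarrow> 'w bot. C_linear_on X C Q \<and> (\<forall>x\<in>X. P x \<le> Q x \<and> Q x \<le> H x)"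
proof -
  have C: "C \<subseteq> X \<times> X" "refl_on X C" "trans C" "sym C"
    and C_scale: "\<And>r x. r > 0 \<Longrightarrow> x \<in> X \<Longrightarrow> (r *\<^sub>R x, x) \<in> C"
    and C_add: "\<And>x y z. (x, y) \<in> C \<Longrightarrow> (y, z) \<in> C \<Longrightarrow> (x + y, z) \<in> C"
    using assms(2) unfolding convex_conic_sym_preorder_def by blast+
  define between where "between K Q \<longleftrightarrow>
    (\<forall>r>0. \<forall>x\<in>K. Q (r *\<^sub>R x) = r *\<^sub>R Q x) \<and>
    (\<forall>x\<in>K. \<forall>y\<in>K. Q (x + y) = Q x + Q y) \<and> (\<forall>x\<in>K. P x \<le> Q x \<and> Q x \<le> H x)"
    for K and Q :: "'v \<Rightarrow> 'w bot"
  \<comment> \<open>Any two points of one class are related, so the inequalities for related pairs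
    hold there without restriction.\<close>
  have ex_between: "\<exists>Q. between (C `` {x}) Q" for x
    unfolding between_def
  proof (rule cone_sandwich_bot)
    have K_X: "y \<in> X" if "y \<in> C `` {x}" for y
      using that C(1) by blast
    have K_C: "(y, z) \<in> C" if "y \<in> C `` {x}" "z \<in> C `` {x}" for y z
      using that C(3,4) by (meson Image_singleton_iff symD transD)
    show "r *\<^sub>R y \<in> C `` {x}" if "r > 0" "y \<in> C `` {x}" for r y
      using C_scale[OF that(1) K_X[OF that(2)]] that(2) C(3,4)
      by (meson Image_singleton_iff symD transD)
    show "y + z \<in> C `` {x}" if "y \<in> C `` {x}" "z \<in> C `` {x}" for y z
      using C_add[OF K_C[OF that], of x] that(2) C(4) by (meson Image_singleton_iff symD)
    show "P (r *\<^sub>R y) = r *\<^sub>R P y" "H (r *\<^sub>R y) = r *\<^sub>R H y"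
      if "r > 0" "y \<in> C `` {x}" for r y
      using that K_X assms(3,4)
      by (simp_all add: C_superlinear_on_def C_sublinear_on_def pos_homogeneous_on_def)
    show "P y + P z \<le> P (y + z)" "H (y + z) \<le> H y + H z"
      if "y \<in> C `` {x}" "z \<in> C `` {x}" for y z
      using K_X[OF that(1)] K_X[OF that(2)] K_C[OF that] assms(3,4)
      by (simp_all add: C_superlinear_on_def C_sublinear_on_def)
    show "P y \<le> H y" if "y \<in> C `` {x}" for y
      using that K_X assms(6) by blast
  qed
  \<comment> \<open>The choice depends on the class as a set, not on a representative, so related
    points use the same additive map.\<close>
  define S where "S K = (SOME Q. between K Q)" for K
  have S: "between (C `` {x}) (S (C `` {x}))" for x
    unfolding S_def by (rule someI_ex[OF ex_between])
  define Q where "Q x = S (C `` {x}) x" for x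
  have Q_eq: "Q y = S (C `` {x}) y" if "(x, y) \<in> C" for x y
  proof -
    have "C `` {x} = C `` {y}"
      using that C(3,4) by (auto dest: symD transD)
    then show ?thesis by (simp add: Q_def)
  qed
  have refl: "(x, x) \<in> C" if "x \<in> X" for x
    using C(2) that by (rule refl_onD)
  have "Q (r *\<^sub>R x) = r *\<^sub>R Q x" if "r > 0" "x \<in> X" for r x
    using S[of x] refl[OF that(2)] Q_eq[of x "r *\<^sub>R x"] C_scale[OF that] C(4) that(1)
    unfolding between_def Q_def[of x] by (metis Image_singleton_iff symD)
  moreover have "Q (x + y) = Q x + Q y" if "x \<in> X" "(x, y) \<in> C" for x y
  proof -
    \<comment> \<open>Symmetry gives \<open>(y, x) \<in> C\<close>, so \<open>x + y\<close> stays in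
      the class of \<open>x\<close> and one chosen map computes all three values.\<close>
    have "(x, x + y) \<in> C"
      using C_add[OF that(2), of x] that(2) C(4) by (meson symD)
    then show ?thesis
      using S[of x] refl[OF that(1)] that(2) by (simp add: Q_eq[of x] between_def)
  qed
  moreover have "P x \<le> Q x \<and> Q x \<le> H x" if "x \<in> X" for x
    using S[of x] refl[OF that] by (simp add: Q_def between_def)
  ultimately show ?thesis
    by (intro exI[of _ Q]) (simp add: C_linear_on_def pos_homogeneous_on_def)
qed

end
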